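(* There is a functor $\mathcal F_{\mathrm{LTrop;unit}}:\mathrm{ValMon}^+\to\mathrm{ULayBidom}^\dagger\times\mathrm{ValMon}_{(1)}$, given as follows: $\mathcal F_{\mathrm{LTrop;unit}}((\mathcal M,\mathcal G,v))=(\mathscr R(L,\mathcal G),\mathcal M_{(1)})$ and, for a morphism $\phi=(\phi_{\mathcal M},\phi_{\mathcal G}):(\mathcal M,\mathcal G,v)\to(\mathcal M',\mathcal G',v')$, $\mathcal F_{\mathrm{LTrop;unit}}(\phi)=(\alpha_\phi,\phi|_{\mathcal M_{(1)}})$, where the morphism $\alpha_\phi:\mathscr R(L,\mathcal G)\to\mathscr R(L,\mathcal G')$ is given by $\alpha_\phi((\ell,a))=(\ell,\phi_{\mathcal G}(a))$ for $\ell\in L$, $a\in\mathcal G$.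
   Context: All monoids are commutative. A semiring$^\dagger$ is a semiring with multiplicative unit but not necessarily with zero; homomorphisms preserve $+$, $\cdot$, $1$. A partial pre-order is a transitive relation (understood to be reflexive). A totally ordered monoid satisfies $b\le c\Rightarrow ab\le ac$. $\mathrm{ValMon}$ is the category whose objects are triples $(\mathcal M,\mathcal G,v)$ with $\mathcal M$ a monoid, $\mathcal G$ a totally ordered monoid and $v:\mathcal M\to\mathcal G$ an onto monoid homomorphism (an m-valuation). A morphism $(\mathcal M,\mathcal G,v)\to(\mathcal M',\mathcal G',v')$ is a pair $(\phi_{\mathcal M},\phi_{\mathcal G})$ of a monoid homomorphism $\phi_{\mathcal M}:\mathcal M\to\mathcal M'$ and an order-preserving monoid homomorphism $\phi_{\mathcal G}:\mathcal G\to\mathcal G'$ with $v'(\phi_{\mathcal M}(a))=\phi_{\mathcal G}(v(a))$ for all $a\in\mathcal M$. $\mathrm{ValMon}^+$ is the full subcategory in which $\mathcal G$ is cancellative. The unit submonoid of $(\mathcal M,\mathcal G,v)$ is $\mathcal M_{(1)}=\{a\in\mathcal M:v(a)=1_{\mathcal G}\}$, on which $v$ restricts to the trivial valuation. $\mathrm{ValMon}_{(1)}$ is the full subcategory of $\mathrm{ValMon}$ consisting of unit monoids with their (trivial) m-valuation. Fix a semiring$^\dagger$ $L$ with a partial pre-order $\ge$ respected by addition and multiplication, all of whose elements are positive, so that $\ell+k\ge\ell$. If $L$ has an infinite element $\infty$, then $\infty+a=\infty=\infty\cdot a$. An $L$-layered pre-domain$^\dagger$ is a semiring$^\dagger$ $R$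 with a partition $R=\dot\bigcup_{\ell\in L}R_\ell$ and maps $\nu_{m,\ell}:R_\ell\to R_m$ for $m\ge\ell$, with $\nu_{\ell,\ell}=\mathrm{id}$ and $\nu_{m,\ell}\circ\nu_{\ell,k}=\nu_{m,k}$ for $m\ge\ell\ge k$. Write $s(a)=k$ for $a\in R_k$, and for $a\in R_k,b\in R_\ell$ write $a\cong_\nu b$ if $\nu_{m,k}(a)=\nu_{m,\ell}(b)$ for some $m\ge k,\ell$. Axioms: (A1) $1_R\in R_1$. (A2) $R_kR_\ell\subseteq R_{k\ell}$. (A3) $\nu_{m,k}(a)\nu_{m',\ell}(b)=\nu_{mm',k\ell}(ab)$ for $a\in R_k$, $b\in R_\ell$, $m\ge k$, $m'\ge\ell$. (A4) $\nu_{\ell,k}(a)+\nu_{\ell',k}(a)=\nu_{\ell+\ell',k}(a)$ for $a\in R_k$, $\ell,\ell'\ge k$. (B) If $a\in R_k$, $b\in R_\ell$, $a\cong_\nu b$, then $a+b\in R_{k+\ell}$ and $a+b\cong_\nu a$; if moreover $k=\infty$, then $a+b=a$. An $L$-layered bidomain$^\dagger$ is an $L$-layered pre-domain$^\dagger$ that is $\nu$-bipotent ($a+b\cong_\nu a$ or $a+b\cong_\nu b$ for all $a,b$) and multiplicatively cancellative; it is uniform if $\nu_{\ell,k}$ is bijective for all $\ell>k$. A layered homomorphism is a pair $(\varphi,\rho)$ of semiring$^\dagger$ homomorphisms $\varphi:R\to R'$, $\rho:L\to L'$ with $s'(\varphi(a))\ge\rho(s(a))$ for all $a$, and $a\cong_\nu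 b\Rightarrow\varphi(a)\cong_\nu\varphi(b)$. $\mathrm{ULayBidom}^\dagger$ is the category of uniform $L$-layered bidomains$^\dagger$ and layered homomorphisms. $\mathscr R(L,\mathcal G)$ is the set $L\times\mathcal G$ with $(k,a)(\ell,b)=(k\ell,ab)$ and $(k,a)+(\ell,b)=(k,a)$ if $a>b$, $(\ell,b)$ if $a<b$, $(k+\ell,a)$ if $a=b$; its layers are $\{\ell\}\times\mathcal G$ and $\nu_{m,\ell}(\ell,a)=(m,a)$.
   Formalization: L is assumed multiplicatively cancellative (else R(L,G) is not a bidomain); order-preserving homomorphisms of value monoids preserve strict order (else α_φ is not additive unless L has one element); ρ in layered homomorphisms is monotone (else they are not closed under composition). *)

theory Defs
  imports "HOL-Algebra.Divisibility"
begin

section \<open>Categories and functors\<close>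

text \<open>A morphism is only considered relative to its domain and codomain:
  \<open>Comp C X Y Z g f\<close> is the composite of \<open>f : X \<rightarrow> Y\<close> and \<open>g : Y \<rightarrow> Z\<close>.\<close>

record ('o, 'a) cat =
  Ob :: "'o set"
  Hom :: "'o \<Rightarrow> 'o \<Rightarrow> 'a set"
  Ident :: "'o \<Rightarrow> 'a"
  Comp :: "'o \<Rightarrow> 'o \<Rightarrow> 'o \<Rightarrow> 'a \<Rightarrow> 'a \<Rightarrow> 'a"

locale category =
  fixes C :: "('o, 'a) cat"
  assumes Id_in_Hom: "X \<in> Ob C \<Longrightarrow> Ident C X \<in> Hom C X X"
    and Comp_in_Hom: "\<lbrakk>X \<in> Ob C; Y \<in> Ob C; Z \<in> Ob C; f \<in> Hom C X Y; g \<in> Hom C Y Z\<rbrakk>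
      \<Longrightarrow> Comp C X Y Z g f \<in> Hom C X Z"
    and Comp_Id_right: "\<lbrakk>X \<in> Ob C; Y \<in> Ob C; f \<in> Hom C X Y\<rbrakk> \<Longrightarrow> Comp C X X Y f (Ident C X) = f"
    and Comp_Id_left: "\<lbrakk>X \<in> Ob C; Y \<in> Ob C; f \<in> Hom C X Y\<rbrakk> \<Longrightarrow> Comp C X Y Y (Ident C Y) f = f"
    and Comp_assoc: "\<lbrakk>W \<in> Ob C; X \<in> Ob C; Y \<in> Ob C; Z \<in> Ob C;
        f \<in> Hom C W X; g \<in> Hom C X Y; h \<in> Hom C Y Z\<rbrakk>
      \<Longrightarrow> Comp C W Y Z h (Comp C W X Y g f) = Comp C W X Z (Comp C X Y Z h g) f"

definition full_subcategory :: "('o, 'a) cat \<Rightarrow> 'o set \<Rightarrow> ('o, 'a) cat"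
  where "full_subcategory C S = C\<lparr>Ob := Ob C \<inter> S\<rparr>"

definition product_category ::
    "('o, 'a) cat \<Rightarrow> ('p, 'b) cat \<Rightarrow> ('o \<times> 'p, 'a \<times> 'b) cat"
  where "product_category C D = \<lparr>
    Ob = Ob C \<times> Ob D,
    Hom = (\<lambda>X Y. Hom C (fst X) (fst Y) \<times> Hom D (snd X) (snd Y)),
    Ident = (\<lambda>X. (Ident C (fst X), Ident D (snd X))),
    Comp = (\<lambda>X Y Z g f. (Comp C (fst X) (fst Y) (fst Z) (fst g) (fst f),
                          Comp D (snd X) (snd Y) (snd Z) (snd g) (snd f)))\<rparr>"

locale is_functor = source: category C + target: category D
  for C :: "('o, 'a) cat" and D :: "('p, 'b) cat" +
  fixes F_ob :: "'o \<Rightarrow> 'p" and F_mor :: "'o \<Rightarrow> 'o \<Rightarrow> 'a \<Rightarrow> 'b"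
  assumes F_ob_in_Ob: "X \<in> Ob C \<Longrightarrow> F_ob X \<in> Ob D"
    and F_mor_in_Hom: "\<lbrakk>X \<in> Ob C; Y \<in> Ob C; f \<in> Hom C X Y\<rbrakk>
      \<Longrightarrow> F_mor X Y f \<in> Hom D (F_ob X) (F_ob Y)"
    and F_mor_Id: "X \<in> Ob C \<Longrightarrow> F_mor X X (Ident C X) = Ident D (F_ob X)"
    and F_mor_Comp: "\<lbrakk>X \<in> Ob C; Y \<in> Ob C; Z \<in> Ob C; f \<in> Hom C X Y; g \<in> Hom C Y Z\<rbrakk>
      \<Longrightarrow> F_mor X Z (Comp C X Y Z g f)
          = Comp D (F_ob X) (F_ob Y) (F_ob Z) (F_mor Y Z g) (F_mor X Y f)"


section \<open>Monoids with m-valuation\<close>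

text \<open>The library's \<^const>\<open>hom\<close> does not require preservation of the unit. Morphisms are
  extensional functions on the carrier, so that equality of morphisms is equality of maps on the
  carrier.\<close>

definition monoid_homs :: "('a, 'c) monoid_scheme \<Rightarrow> ('b, 'd) monoid_scheme \<Rightarrow> ('a \<Rightarrow> 'b) set"
  where "monoid_homs M N =
    {f \<in> hom M N \<inter> extensional (carrier M). f \<one>\<^bsub>M\<^esub> = \<one>\<^bsub>N\<^esub>}"

text \<open>\<open>(a, b) \<in> le G\<close> means \<open>a \<le> b\<close>.\<close>

record 'g ord_monoid = "'g monoid" +
  le :: "('g \<times> 'g) set"

definition strict_less :: "('g, 'c) ord_monoid_scheme \<Rightarrow> 'g \<Rightarrow> 'g \<Rightarrow> bool"
  where "strict_less G a b \<longleftrightarrow> (a, b) \<in> le G \<and> a \<noteq> b"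

locale tot_ord_monoid = comm_monoid G for G :: "('g, 'c) ord_monoid_scheme" (structure) +
  assumes linear: "linear_order_on (carrier G) (le G)"
    and mult_mono: "\<lbrakk>a \<in> carrier G; b \<in> carrier G; c \<in> carrier G; (b, c) \<in> le G\<rbrakk>
      \<Longrightarrow> (a \<otimes> b, a \<otimes> c) \<in> le G"

text \<open>A homomorphism of totally ordered monoids preserves the strict order \<open>>\<close>, the relation in
  terms of which addition on \<open>L \<times> G\<close> is defined. Preserving only \<open>\<ge>\<close> is not enough for
  \<open>(\<ell>, a) \<mapsto> (\<ell>, \<phi> a)\<close> to be additive; see \<open>layered_map_additive_imp_strict\<close>.\<close>

definition ord_monoid_homs ::
    "('g, 'c) ord_monoid_scheme \<Rightarrow> ('h, 'd) ord_monoid_scheme \<Rightarrow> ('g \<Rightarrow> 'h) set"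
  where "ord_monoid_homs G H = {f \<in> monoid_homs G H.
    \<forall>a \<in> carrier G. \<forall>b \<in> carrier G. strict_less G a b \<longrightarrow> strict_less H (f a) (f b)}"

record ('m, 'g) valued_monoid =
  dom_monoid :: "'m monoid"
  val_monoid :: "'g ord_monoid"
  valuation :: "'m \<Rightarrow> 'g"

definition m_valuation :: "('m, 'g) valued_monoid \<Rightarrow> bool"
  where "m_valuation V \<longleftrightarrow>
    comm_monoid (dom_monoid V) \<and> tot_ord_monoid (val_monoid V) \<and>
    valuation V \<in> monoid_homs (dom_monoid V) (val_monoid V) \<and>
    valuation V ` carrier (dom_monoid V) = carrier (val_monoid V)"

definition ValMon :: "(('m, 'g) valued_monoid, ('m \<Rightarrow> 'm) \<times> ('g \<Rightarrow> 'g)) cat"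
  where "ValMon = \<lparr>
    Ob = {V. m_valuation V},
    Hom = (\<lambda>V W. {(f, g). f \<in> monoid_homs (dom_monoid V) (dom_monoid W) \<and>
                          g \<in> ord_monoid_homs (val_monoid V) (val_monoid W) \<and>
                          (\<forall>a \<in> carrier (dom_monoid V). valuation W (f a) = g (valuation V a))}),
    Ident = (\<lambda>V. (\<lambda>a \<in> carrier (dom_monoid V). a, \<lambda>b \<in> carrier (val_monoid V). b)),
    Comp = (\<lambda>U V W q p. (compose (carrier (dom_monoid U)) (fst q) (fst p),
                          compose (carrier (val_monoid U)) (snd q) (snd p)))\<rparr>"

definition ValMon_plus :: "(('m, 'g) valued_monoid, ('m \<Rightarrow> 'm) \<times> ('g \<Rightarrow> 'g)) cat"
  where "ValMon_plus = full_subcategory ValMon {V. comm_monoid_cancel (val_monoid V)}"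

text \<open>Since an m-valuation is onto, the value monoid of the unit monoid is the trivial
  submonoid.\<close>

definition unit_submonoid :: "('m, 'g) valued_monoid \<Rightarrow> ('m, 'g) valued_monoid"
  where "unit_submonoid V =
    (let M1 = {a \<in> carrier (dom_monoid V). valuation V a = \<one>\<^bsub>val_monoid V\<^esub>};
         G1 = {\<one>\<^bsub>val_monoid V\<^esub>}
     in \<lparr>dom_monoid = (dom_monoid V)\<lparr>carrier := M1\<rparr>,
         val_monoid = (val_monoid V)\<lparr>carrier := G1, le := le (val_monoid V) \<inter> G1 \<times> G1\<rparr>,
         valuation = restrict (valuation V) M1\<rparr>)"

definition ValMon_unit :: "(('m, 'g) valued_monoid, ('m \<Rightarrow> 'm) \<times> ('g \<Rightarrow> 'g)) cat"
  where "ValMon_unit = full_subcategory ValMon (unit_submonoid ` Ob ValMon)"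


section \<open>Layered bidomains\<close>

text \<open>Semirings with unit but without a distinguished zero, hence not the library's
  \<open>semiring\<close> locale.\<close>

record 'r semiring1 = "'r monoid" +
  splus :: "'r \<Rightarrow> 'r \<Rightarrow> 'r"  (infixl \<open>\<boxplus>\<index>\<close> 65)

locale comm_semiring1 = comm_monoid R for R :: "('r, 'c) semiring1_scheme" (structure) +
  assumes splus_closed: "\<lbrakk>a \<in> carrier R; b \<in> carrier R\<rbrakk> \<Longrightarrow> a \<boxplus> b \<in> carrier R"
    and splus_assoc: "\<lbrakk>a \<in> carrier R; b \<in> carrier R; c \<in> carrier R\<rbrakk>
      \<Longrightarrow> (a \<boxplus> b) \<boxplus> c = a \<boxplus> (b \<boxplus> c)"
    and splus_comm: "\<lbrakk>a \<in> carrier R; b \<in> carrier R\<rbrakk> \<Longrightarrow> a \<boxplus> b = b \<boxplus> a"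
    and distrib: "\<lbrakk>a \<in> carrier R; b \<in> carrier R; c \<in> carrier R\<rbrakk>
      \<Longrightarrow> a \<otimes> (b \<boxplus> c) = (a \<otimes> b) \<boxplus> (a \<otimes> c)"

definition semiring1_homs ::
    "('r, 'c) semiring1_scheme \<Rightarrow> ('t, 'd) semiring1_scheme \<Rightarrow> ('r \<Rightarrow> 't) set"
  where "semiring1_homs R T = {f \<in> monoid_homs R T.
    \<forall>a \<in> carrier R. \<forall>b \<in> carrier R. f (a \<boxplus>\<^bsub>R\<^esub> b) = f a \<boxplus>\<^bsub>T\<^esub> f b}"

text \<open>\<open>(k, m) \<in> layer_le L\<close> means \<open>m \<ge> k\<close>.\<close>

record 'l layering = "'l semiring1" +
  layer_le :: "('l \<times> 'l) set"

locale layering_semiring = comm_semiring1 L for L :: "('l, 'c) layering_scheme" (structure) +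
  assumes preorder: "preorder_on (carrier L) (layer_le L)"
    and splus_mono: "\<lbrakk>k \<in> carrier L; l \<in> carrier L; m \<in> carrier L; (k, l) \<in> layer_le L\<rbrakk>
      \<Longrightarrow> (m \<boxplus> k, m \<boxplus> l) \<in> layer_le L"
    and mult_mono: "\<lbrakk>k \<in> carrier L; l \<in> carrier L; m \<in> carrier L; (k, l) \<in> layer_le L\<rbrakk>
      \<Longrightarrow> (m \<otimes> k, m \<otimes> l) \<in> layer_le L"
    and positive: "\<lbrakk>k \<in> carrier L; l \<in> carrier L\<rbrakk> \<Longrightarrow> (l, l \<boxplus> k) \<in> layer_le L"

text \<open>There is at most one such element, and by positivity it is a largest element.\<close>

definition infinite_layer :: "('l, 'c) layering_scheme \<Rightarrow> 'l \<Rightarrow> bool"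
  where "infinite_layer L e \<longleftrightarrow> e \<in> carrier L \<and>
    (\<forall>a \<in> carrier L. e \<boxplus>\<^bsub>L\<^esub> a = e \<and> e \<otimes>\<^bsub>L\<^esub> a = e)"

text \<open>The partition into layers is given by the sorting map \<open>s\<close>, and
  \<open>transit R m l\<close> is the map \<open>\<nu>\<^bsub>m,l\<^esub>\<close> from the layer of \<open>l\<close> to the layer of \<open>m\<close>.\<close>

record ('r, 'l) layered = "'r semiring1" +
  sorting :: "'r \<Rightarrow> 'l"
  transit :: "'l \<Rightarrow> 'l \<Rightarrow> 'r \<Rightarrow> 'r"

definition layer :: "('r, 'l) layered \<Rightarrow> 'l \<Rightarrow> 'r set"
  where "layer R l = {a \<in> carrier R. sorting R a = l}"

definition nu_equiv :: "'l layering \<Rightarrow> ('r, 'l) layered \<Rightarrow> 'r \<Rightarrow> 'r \<Rightarrow> bool"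
  where "nu_equiv L R a b \<longleftrightarrow> (\<exists>m \<in> carrier L.
    (sorting R a, m) \<in> layer_le L \<and> (sorting R b, m) \<in> layer_le L \<and>
    transit R m (sorting R a) a = transit R m (sorting R b) b)"

locale layered_predomain =
  L: layering_semiring L + R: comm_semiring1 R
  for L :: "'l layering" and R :: "('r, 'l) layered" +
  assumes sorting_closed: "a \<in> carrier R \<Longrightarrow> sorting R a \<in> carrier L"
    and transit_closed: "\<lbrakk>l \<in> carrier L; m \<in> carrier L; (l, m) \<in> layer_le L; a \<in> layer R l\<rbrakk>
      \<Longrightarrow> transit R m l a \<in> layer R m"
    and transit_id: "\<lbrakk>l \<in> carrier L; a \<in> layer R l\<rbrakk> \<Longrightarrow> transit R l l a = a"
    and transit_comp: "\<lbrakk>k \<in> carrier L; l \<in> carrier L; m \<in> carrier L;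
        (k, l) \<in> layer_le L; (l, m) \<in> layer_le L; a \<in> layer R k\<rbrakk>
      \<Longrightarrow> transit R m l (transit R l k a) = transit R m k a"
    and A1: "\<one>\<^bsub>R\<^esub> \<in> layer R \<one>\<^bsub>L\<^esub>"
    and A2: "\<lbrakk>k \<in> carrier L; l \<in> carrier L; a \<in> layer R k; b \<in> layer R l\<rbrakk>
      \<Longrightarrow> a \<otimes>\<^bsub>R\<^esub> b \<in> layer R (k \<otimes>\<^bsub>L\<^esub> l)"
    and A3: "\<lbrakk>k \<in> carrier L; l \<in> carrier L; m \<in> carrier L; m' \<in> carrier L;
        a \<in> layer R k; b \<in> layer R l; (k, m) \<in> layer_le L; (l, m') \<in> layer_le L\<rbrakk>
      \<Longrightarrow> transit R m k a \<otimes>\<^bsub>R\<^esub> transit R m' l b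
          = transit R (m \<otimes>\<^bsub>L\<^esub> m') (k \<otimes>\<^bsub>L\<^esub> l) (a \<otimes>\<^bsub>R\<^esub> b)"
    and A4: "\<lbrakk>k \<in> carrier L; l \<in> carrier L; l' \<in> carrier L;
        a \<in> layer R k; (k, l) \<in> layer_le L; (k, l') \<in> layer_le L\<rbrakk>
      \<Longrightarrow> transit R l k a \<boxplus>\<^bsub>R\<^esub> transit R l' k a = transit R (l \<boxplus>\<^bsub>L\<^esub> l') k a"
    and B: "\<lbrakk>k \<in> carrier L; l \<in> carrier L; a \<in> layer R k; b \<in> layer R l; nu_equiv L R a b\<rbrakk>
      \<Longrightarrow> a \<boxplus>\<^bsub>R\<^esub> b \<in> layer R (k \<boxplus>\<^bsub>L\<^esub> l) \<and> nu_equiv L R (a \<boxplus>\<^bsub>R\<^esub> b) a"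
    and B_infinite: "\<lbrakk>k \<in> carrier L; l \<in> carrier L; a \<in> layer R k; b \<in> layer R l;
        nu_equiv L R a b; infinite_layer L k\<rbrakk>
      \<Longrightarrow> a \<boxplus>\<^bsub>R\<^esub> b = a"

locale layered_bidomain = layered_predomain L R + R: comm_monoid_cancel R
  for L :: "'l layering" and R :: "('r, 'l) layered" +
  assumes nu_bipotent: "\<lbrakk>a \<in> carrier R; b \<in> carrier R\<rbrakk>
      \<Longrightarrow> nu_equiv L R (a \<boxplus>\<^bsub>R\<^esub> b) a \<or> nu_equiv L R (a \<boxplus>\<^bsub>R\<^esub> b) b"

locale uniform_layered_bidomain = layered_bidomain L R
  for L :: "'l layering" and R :: "('r, 'l) layered" +
  assumes transit_bij: "\<lbrakk>k \<in> carrier L; l \<in> carrier L; (k, l) \<in> layer_le L; k \<noteq> l\<rbrakk>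
      \<Longrightarrow> bij_betw (transit R l k) (layer R k) (layer R l)"

text \<open>Homomorphisms of preordered layering semirings are monotone: without this, the condition
  \<open>s'(\<phi> a) \<ge> \<rho> (s a)\<close> is not stable under composition.\<close>

definition layering_homs :: "'l layering \<Rightarrow> 'l layering \<Rightarrow> ('l \<Rightarrow> 'l) set"
  where "layering_homs L L' = {\<rho> \<in> semiring1_homs L L'.
    \<forall>k \<in> carrier L. \<forall>l \<in> carrier L. (k, l) \<in> layer_le L \<longrightarrow> (\<rho> k, \<rho> l) \<in> layer_le L'}"

text \<open>An object is a pair of a layering semiring and a bidomain layered by it.\<close>

definition ULayBidom ::
    "('l layering \<times> ('r, 'l) layered, ('r \<Rightarrow> 'r) \<times> ('l \<Rightarrow> 'l)) cat"
  where "ULayBidom = \<lparr>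
    Ob = {(L, R). uniform_layered_bidomain L R},
    Hom = (\<lambda>(L, R) (L', R'). {(\<phi>, \<rho>). \<phi> \<in> semiring1_homs R R' \<and> \<rho> \<in> layering_homs L L' \<and>
      (\<forall>a \<in> carrier R. (\<rho> (sorting R a), sorting R' (\<phi> a)) \<in> layer_le L') \<and>
      (\<forall>a \<in> carrier R. \<forall>b \<in> carrier R. nu_equiv L R a b \<longrightarrow> nu_equiv L' R' (\<phi> a) (\<phi> b))}),
    Ident = (\<lambda>(L, R). (\<lambda>a \<in> carrier R. a, \<lambda>l \<in> carrier L. l)),
    Comp = (\<lambda>(L, R) _ _ q p. (compose (carrier R) (fst q) (fst p),
                               compose (carrier L) (snd q) (snd p)))\<rparr>"


section \<open>The layered semiring of an ordered monoid and the functor\<close>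

definition layered_of :: "'l layering \<Rightarrow> 'g ord_monoid \<Rightarrow> ('l \<times> 'g, 'l) layered"
  where "layered_of L G = \<lparr>
    carrier = carrier L \<times> carrier G,
    mult = (\<lambda>(k, a) (l, b). (k \<otimes>\<^bsub>L\<^esub> l, a \<otimes>\<^bsub>G\<^esub> b)),
    one = (\<one>\<^bsub>L\<^esub>, \<one>\<^bsub>G\<^esub>),
    splus = (\<lambda>(k, a) (l, b). if strict_less G b a then (k, a)
                             else if strict_less G a b then (l, b)
                             else (k \<boxplus>\<^bsub>L\<^esub> l, a)),
    sorting = fst,
    transit = (\<lambda>m l (_, a). (m, a))\<rparr>"

definition layered_map :: "'l layering \<Rightarrow> 'g ord_monoid \<Rightarrow> ('g \<Rightarrow> 'h) \<Rightarrow> 'l \<times> 'g \<Rightarrow> 'l \<times> 'h"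
  where "layered_map L G \<phi> = (\<lambda>(l, a) \<in> carrier L \<times> carrier G. (l, \<phi> a))"

definition LTrop_unit_ob ::
    "'l layering \<Rightarrow> ('m, 'g) valued_monoid
      \<Rightarrow> ('l layering \<times> ('l \<times> 'g, 'l) layered) \<times> ('m, 'g) valued_monoid"
  where "LTrop_unit_ob L V = ((L, layered_of L (val_monoid V)), unit_submonoid V)"

definition LTrop_unit_mor ::
    "'l layering \<Rightarrow> ('m, 'g) valued_monoid \<Rightarrow> ('m, 'g) valued_monoid
      \<Rightarrow> ('m \<Rightarrow> 'm) \<times> ('g \<Rightarrow> 'g)
      \<Rightarrow> (('l \<times> 'g \<Rightarrow> 'l \<times> 'g) \<times> ('l \<Rightarrow> 'l)) \<times> (('m \<Rightarrow> 'm) \<times> ('g \<Rightarrow> 'g))"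
  where "LTrop_unit_mor L V W \<phi> =
    ((layered_map L (val_monoid V) (snd \<phi>), \<lambda>l \<in> carrier L. l),
     (restrict (fst \<phi>) (carrier (dom_monoid (unit_submonoid V))),
      restrict (snd \<phi>) (carrier (val_monoid (unit_submonoid V)))))"


section \<open>Necessity of two conditions\<close>

text \<open>The layered semiring can only be cancellative if \<open>L\<close> is.\<close>

lemma layered_of_cancel_imp_cancel:
  assumes "comm_monoid_cancel (layered_of L G)" "comm_monoid L" "comm_monoid G"
  shows "comm_monoid_cancel L"
proof -
  interpret R: comm_monoid_cancel "layered_of L G" by fact
  interpret L: comm_monoid L by fact
  interpret G: comm_monoid G by fact
  show ?thesis
  proof (rule comm_monoid_cancelI)
    fix a b c assume "a \<otimes>\<^bsub>L\<^esub> c = b \<otimes>\<^bsub>L\<^esub> c" "a \<in> carrier L" "b \<in> carrier L" "c \<in> carrier L"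
    then show "a = b"
      using R.r_cancel[of "(a, \<one>\<^bsub>G\<^esub>)" "(c, \<one>\<^bsub>G\<^esub>)" "(b, \<one>\<^bsub>G\<^esub>)"] by (simp add: layered_of_def)
  qed fact
qed

text \<open>Unless \<open>L\<close> has only one element, \<open>layered_map L G \<phi>\<close> is additive only if the weakly
  monotone map \<open>\<phi>\<close> is strictly monotone.\<close>

lemma layered_map_additive_imp_strict:
  assumes L: "comm_semiring1 L" "k \<in> carrier L" "l \<in> carrier L" "k \<noteq> l"
    and G: "tot_ord_monoid G"
    and ab: "a \<in> carrier G" "b \<in> carrier G" "strict_less G a b"
    and mono: "(\<phi> a, \<phi> b) \<in> le H"
    and additive: "\<And>x y. \<lbrakk>x \<in> carrier (layered_of L G); y \<in> carrier (layered_of L G)\<rbrakk> \<Longrightarrow>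
      layered_map L G \<phi> (x \<boxplus>\<^bsub>layered_of L G\<^esub> y)
        = layered_map L G \<phi> x \<boxplus>\<^bsub>layered_of L H\<^esub> layered_map L G \<phi> y"
  shows "strict_less H (\<phi> a) (\<phi> b)"
proof (rule ccontr)
  assume "\<not> strict_less H (\<phi> a) (\<phi> b)"
  then have eq: "\<phi> a = \<phi> b" using mono by (simp add: strict_less_def)
  have "antisym (le G)"
    using tot_ord_monoid.linear[OF G] by (simp add: linear_order_on_def partial_order_on_def)
  then have anti: "(b, a) \<notin> le G" using ab by (auto simp: strict_less_def dest: antisymD)
  have absorb: "m = n \<boxplus>\<^bsub>L\<^esub> m" if "m \<in> carrier L" "n \<in> carrier L" for m n
    using additive[of "(n, a)" "(m, b)"] that ab anti eq
    by (simp add: layered_of_def layered_map_def strict_less_def)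
  then have "k = l" using L comm_semiring1.splus_comm[OF L(1), of k l] by metis
  then show False using L by simp
qed

end

theory Submission
  imports Defs
begin

section \<open>Morphisms of monoids and semirings\<close>

text \<open>A functor into a product is a pair of functors, so once both targets are known to be
  categories, the layered half and the unit half can be treated separately.

  In L x G the transit maps change only the layer. Two elements are therefore nu-equivalent exactly
  when their second coordinates agree and their layers have a common bound
  (\<open>nu_equiv_layered_of\<close>), and k + l is such a bound by positivity. The axioms on
  layers thus become laws of L. The work lies in the semiring laws
  (\<open>comm_semiring1_R\<close>): a sum keeps the summand of larger value and adds layers on a
  tie, so strict comparisons in G decide everything. Associativity is a case split on them;
  distributivity needs multiplication in G to preserve >, which cancellation provides
  (\<open>strict_less_mult\<close>). Cancellation in L and in G gives cancellation in L x G, and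
  \<open>uniform_layered_bidomain_R\<close> follows.

  A strictly monotone \<phi> respects the three cases of a sum, so (l, a) |-> (l, \<phi> a) is
  additive (\<open>layered_map_in_semiring1_homs\<close>). In the other half, v'(f a) = g(v a) = g 1
  = 1 for a in the unit submonoid, so morphisms restrict (\<open>Hom_ValMon_unit_submonoid\<close>).
  Identities and composites are compared pointwise, all maps being extensional.\<close>

lemma monoid_homsD:
  assumes "f \<in> monoid_homs M N"
  shows "f \<in> carrier M \<rightarrow> carrier N"
    and "f \<in> extensional (carrier M)"
    and "f \<one>\<^bsub>M\<^esub> = \<one>\<^bsub>N\<^esub>"
    and "\<lbrakk>a \<in> carrier M; b \<in> carrier M\<rbrakk> \<Longrightarrow> f (a \<otimes>\<^bsub>M\<^esub> b) = f a \<otimes>\<^bsub>N\<^esub> f b"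
  using assms by (auto simp: monoid_homs_def hom_def)

lemma monoid_homs_closed:
  "\<lbrakk>f \<in> monoid_homs M N; a \<in> carrier M\<rbrakk> \<Longrightarrow> f a \<in> carrier N"
  using monoid_homsD(1) by fastforce

lemma monoid_homs_id:
  assumes "monoid M"
  shows "(\<lambda>a \<in> carrier M. a) \<in> monoid_homs M M"
  using assms by (auto simp: monoid_homs_def hom_def monoid.m_closed monoid.one_closed)

lemma monoid_homs_compose:
  assumes "monoid M" "f \<in> monoid_homs M N" "g \<in> monoid_homs N P"
  shows "compose (carrier M) g f \<in> monoid_homs M P"
  using assms
  by (auto simp: monoid_homs_def hom_def compose_eq monoid.m_closed monoid.one_closed Pi_iff)

lemma compose_monoid_homs_assoc:
  assumes "f \<in> monoid_homs M N"
  shows "compose (carrier M) (compose (carrier N) h g) f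
    = compose (carrier M) h (compose (carrier M) g f)"
  by (rule compose_assoc[OF monoid_homsD(1)[OF assms], symmetric])

lemma ord_monoid_homsD:
  assumes "f \<in> ord_monoid_homs G H"
  shows "f \<in> monoid_homs G H"
    and "\<lbrakk>a \<in> carrier G; b \<in> carrier G; strict_less G a b\<rbrakk> \<Longrightarrow> strict_less H (f a) (f b)"
  using assms by (auto simp: ord_monoid_homs_def)

lemma ord_monoid_homs_id:
  "monoid G \<Longrightarrow> (\<lambda>a \<in> carrier G. a) \<in> ord_monoid_homs G G"
  by (simp add: ord_monoid_homs_def monoid_homs_id)

lemma ord_monoid_homs_compose:
  assumes "monoid G" "f \<in> ord_monoid_homs G H" "g \<in> ord_monoid_homs H K"
  shows "compose (carrier G) g f \<in> ord_monoid_homs G K"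
  using assms
  by (auto simp: ord_monoid_homs_def compose_eq monoid_homs_compose monoid_homs_closed)

lemma semiring1_homs_id:
  assumes "comm_semiring1 R"
  shows "(\<lambda>a \<in> carrier R. a) \<in> semiring1_homs R R"
proof -
  interpret comm_semiring1 R by fact
  show ?thesis
    by (simp add: semiring1_homs_def monoid_homs_id monoid_axioms splus_closed)
qed

lemma semiring1_homs_compose:
  assumes "comm_semiring1 R" "f \<in> semiring1_homs R S" "g \<in> semiring1_homs S T"
  shows "compose (carrier R) g f \<in> semiring1_homs R T"
proof -
  interpret comm_semiring1 R by fact
  show ?thesis
    using assms(2,3)
    by (auto simp: semiring1_homs_def compose_eq monoid_homs_compose monoid_axioms
        monoid_homs_closed splus_closed)
qed

lemma layering_homs_id:
  assumes "comm_semiring1 L"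
  shows "(\<lambda>l \<in> carrier L. l) \<in> layering_homs L L"
  using assms by (simp add: layering_homs_def semiring1_homs_id)

lemma semiring1_homs_monoid_homs: "f \<in> semiring1_homs R S \<Longrightarrow> f \<in> monoid_homs R S"
  by (simp add: semiring1_homs_def)

lemma layering_homs_monoid_homs: "\<rho> \<in> layering_homs L L' \<Longrightarrow> \<rho> \<in> monoid_homs L L'"
  by (simp add: layering_homs_def semiring1_homs_def)

lemma layering_homs_compose:
  assumes "comm_semiring1 L" "\<rho> \<in> layering_homs L L'" "\<sigma> \<in> layering_homs L' L''"
  shows "compose (carrier L) \<sigma> \<rho> \<in> layering_homs L L''"
  using assms monoid_homs_closed[OF layering_homs_monoid_homs[OF assms(2)]]
  by (auto simp: layering_homs_def compose_eq semiring1_homs_compose)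

text \<open>Identity arrows are identities cut down to the carrier, so the unit laws hold as
  equalities because morphisms are extensional.\<close>

lemma compose_restrict_id_right:
  "f \<in> extensional A \<Longrightarrow> compose A f (\<lambda>x \<in> A. x) = f"
  by (auto simp: compose_def extensional_def)

lemma compose_restrict_id_left:
  "\<lbrakk>f \<in> A \<rightarrow> B; f \<in> extensional A\<rbrakk> \<Longrightarrow> compose A (\<lambda>y \<in> B. y) f = f"
  by (auto simp: compose_def extensional_def Pi_iff)


section \<open>The categories\<close>

lemma category_full_subcategory:
  assumes "category C"
  shows "category (full_subcategory C S)"
proof -
  interpret category C by fact
  show ?thesis
    by unfold_locales
      (auto simp: full_subcategory_def Id_in_Hom Comp_in_Hom Comp_Id_left Comp_Id_right Comp_assoc)
qed

lemma category_product_category: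
  assumes "category C" "category D"
  shows "category (product_category C D)"
proof -
  interpret C: category C by fact
  interpret D: category D by fact
  show ?thesis
  proof
  qed (auto simp: product_category_def C.Id_in_Hom C.Comp_in_Hom C.Comp_Id_left C.Comp_Id_right
        D.Id_in_Hom D.Comp_in_Hom D.Comp_Id_left D.Comp_Id_right intro: C.Comp_assoc D.Comp_assoc)
qed

section \<open>The category of m-valuations\<close>

lemma m_valuationD:
  assumes "m_valuation V"
  shows "comm_monoid (dom_monoid V)" "monoid (dom_monoid V)"
    and "tot_ord_monoid (val_monoid V)" "monoid (val_monoid V)"
    and "valuation V \<in> monoid_homs (dom_monoid V) (val_monoid V)"
  using assms
  by (auto simp: m_valuation_def tot_ord_monoid_def comm_monoid_def)

lemma category_ValMon: "category ValMon"
proof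
  fix V :: "('m, 'g) valued_monoid" assume "V \<in> Ob ValMon"
  then have "m_valuation V" by (simp add: ValMon_def)
  note V = m_valuationD[OF this]
  show "Ident ValMon V \<in> Hom ValMon V V"
    by (auto simp: ValMon_def monoid_homs_id ord_monoid_homs_id V monoid_homs_closed[OF V(5)])
next
  fix U V W :: "('m, 'g) valued_monoid" and p q
  assume "U \<in> Ob ValMon" "p \<in> Hom ValMon U V" "q \<in> Hom ValMon V W"
  moreover have "valuation U a \<in> carrier (val_monoid U)" if "a \<in> carrier (dom_monoid U)" for a
    using monoid_homs_closed[OF m_valuationD(5) that] \<open>U \<in> Ob ValMon\<close>
    by (simp add: ValMon_def)
  ultimately show "Comp ValMon U V W q p \<in> Hom ValMon U W"
    by (auto simp: ValMon_def compose_eq m_valuationD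
        monoid_homs_compose ord_monoid_homs_compose monoid_homs_closed)
next
  fix U V :: "('m, 'g) valued_monoid" and p
  assume "p \<in> Hom ValMon U V"
  then show "Comp ValMon U U V p (Ident ValMon U) = p"
    and "Comp ValMon U V V (Ident ValMon V) p = p"
    by (auto simp: ValMon_def compose_restrict_id_right compose_restrict_id_left monoid_homsD
        dest!: ord_monoid_homsD(1))
next
  fix T U V W :: "('m, 'g) valued_monoid" and p q r
  assume "p \<in> Hom ValMon T U" "q \<in> Hom ValMon U V" "r \<in> Hom ValMon V W"
  then show "Comp ValMon T V W r (Comp ValMon T U V q p)
    = Comp ValMon T U W (Comp ValMon U V W r q) p"
    by (auto simp: ValMon_def compose_monoid_homs_assoc dest!: ord_monoid_homsD(1))
qed

section \<open>The category of uniform layered bidomains\<close>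

lemma uniform_layered_bidomainD:
  assumes "uniform_layered_bidomain L R"
  shows "layering_semiring L" "comm_semiring1 L" "comm_semiring1 R"
    and "a \<in> carrier R \<Longrightarrow> sorting R a \<in> carrier L"
proof -
  interpret uniform_layered_bidomain L R by fact
  show "layering_semiring L" "comm_semiring1 L" "comm_semiring1 R"
    and "a \<in> carrier R \<Longrightarrow> sorting R a \<in> carrier L"
    by (fact L.layering_semiring_axioms L.comm_semiring1_axioms R.comm_semiring1_axioms
        sorting_closed)+
qed

lemma layer_le_refl:
  "\<lbrakk>layering_semiring L; l \<in> carrier L\<rbrakk> \<Longrightarrow> (l, l) \<in> layer_le L"
  using layering_semiring.preorder[of L] by (auto simp: preorder_on_def refl_on_def)

lemma layer_le_trans:
  "\<lbrakk>layering_semiring L; (k, l) \<in> layer_le L; (l, m) \<in> layer_le L\<rbrakk> \<Longrightarrow> (k, m) \<in> layer_le L"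
  using layering_semiring.preorder[of L] by (auto simp: preorder_on_def dest: transD)

lemma ULayBidom_Hom_iff:
  "(\<phi>, \<rho>) \<in> Hom ULayBidom (L, R) (L', R') \<longleftrightarrow>
    \<phi> \<in> semiring1_homs R R' \<and> \<rho> \<in> layering_homs L L' \<and>
    (\<forall>a \<in> carrier R. (\<rho> (sorting R a), sorting R' (\<phi> a)) \<in> layer_le L') \<and>
    (\<forall>a \<in> carrier R. \<forall>b \<in> carrier R. nu_equiv L R a b \<longrightarrow> nu_equiv L' R' (\<phi> a) (\<phi> b))"
  by (simp add: ULayBidom_def)

text \<open>The sorting condition composes in two steps: monotonicity of \<sigma> is applied to the
  condition for (\<phi>, \<rho>), and the condition for (\<psi>, \<sigma>) is then used at \<phi>
  a.\<close>

lemma ULayBidom_Comp_in_Hom: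
  assumes R: "uniform_layered_bidomain L R" and R': "uniform_layered_bidomain L' R'"
    and R'': "uniform_layered_bidomain L'' R''"
    and p: "(\<phi>, \<rho>) \<in> Hom ULayBidom (L, R) (L', R')"
    and q: "(\<psi>, \<sigma>) \<in> Hom ULayBidom (L', R') (L'', R'')"
  shows "(compose (carrier R) \<psi> \<phi>, compose (carrier L) \<sigma> \<rho>) \<in> Hom ULayBidom (L, R) (L'', R'')"
proof -
  note p = p[unfolded ULayBidom_Hom_iff] and q = q[unfolded ULayBidom_Hom_iff]
  note D = uniform_layered_bidomainD
  have \<phi>: "\<phi> a \<in> carrier R'" if "a \<in> carrier R" for a
    using p that by (auto intro: monoid_homs_closed semiring1_homs_monoid_homs)
  have \<rho>: "\<rho> l \<in> carrier L'" if "l \<in> carrier L" for l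
    using p that by (auto intro: monoid_homs_closed layering_homs_monoid_homs)
  have "(\<sigma> (\<rho> (sorting R a)), sorting R'' (\<psi> (\<phi> a))) \<in> layer_le L''" if a: "a \<in> carrier R" for a
  proof (rule layer_le_trans[OF D(1)[OF R'']])
    show "(\<sigma> (\<rho> (sorting R a)), \<sigma> (sorting R' (\<phi> a))) \<in> layer_le L''"
      using p q a \<phi> \<rho> D(4)[OF R] D(4)[OF R'] by (simp add: layering_homs_def)
    show "(\<sigma> (sorting R' (\<phi> a)), sorting R'' (\<psi> (\<phi> a))) \<in> layer_le L''"
      using q a \<phi> by simp
  qed
  then show ?thesis
    unfolding ULayBidom_Hom_iff
    using p q semiring1_homs_compose[OF D(3)[OF R]] layering_homs_compose[OF D(2)[OF R]]
    by (auto simp: compose_eq \<phi> D(4)[OF R])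
qed

lemma category_ULayBidom: "category ULayBidom"
proof
  fix X :: "'l layering \<times> ('r, 'l) layered" assume X: "X \<in> Ob ULayBidom"
  obtain L R where [simp]: "X = (L, R)" by force
  have "uniform_layered_bidomain L R" using X by (simp add: ULayBidom_def)
  note D = uniform_layered_bidomainD[OF this]
  show "Ident ULayBidom X \<in> Hom ULayBidom X X"
    by (simp add: ULayBidom_def semiring1_homs_id layering_homs_id D layer_le_refl)
next
  fix X Y Z :: "'l layering \<times> ('r, 'l) layered" and p q
  assume "X \<in> Ob ULayBidom" "Y \<in> Ob ULayBidom" "Z \<in> Ob ULayBidom"
    "p \<in> Hom ULayBidom X Y" "q \<in> Hom ULayBidom Y Z"
  moreover have "Comp ULayBidom X Y Z q p
    = (compose (carrier (snd X)) (fst q) (fst p), compose (carrier (fst X)) (snd q) (snd p))"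
    by (simp add: ULayBidom_def split: prod.split)
  ultimately show "Comp ULayBidom X Y Z q p \<in> Hom ULayBidom X Z"
    using ULayBidom_Comp_in_Hom[of "fst X" "snd X" "fst Y" "snd Y" "fst Z" "snd Z"
        "fst p" "snd p" "fst q" "snd q"]
    \<comment> \<open>Only the object set is unfolded; \<open>Hom\<close> stays folded so that the
      lemma on composites still matches.\<close>
    by (simp add: ULayBidom_def[THEN arg_cong[of _ _ Ob]] case_prod_unfold)
next
  fix X Y :: "'l layering \<times> ('r, 'l) layered" and p
  assume "p \<in> Hom ULayBidom X Y"
  then show "Comp ULayBidom X X Y p (Ident ULayBidom X) = p"
    and "Comp ULayBidom X Y Y (Ident ULayBidom Y) p = p"
    by (auto simp: ULayBidom_def compose_restrict_id_right compose_restrict_id_left monoid_homsD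
        split: prod.splits dest!: semiring1_homs_monoid_homs layering_homs_monoid_homs)
next
  fix W X Y Z :: "'l layering \<times> ('r, 'l) layered" and p q r
  assume "p \<in> Hom ULayBidom W X" "q \<in> Hom ULayBidom X Y" "r \<in> Hom ULayBidom Y Z"
  then show "Comp ULayBidom W Y Z r (Comp ULayBidom W X Y q p)
    = Comp ULayBidom W X Z (Comp ULayBidom X Y Z r q) p"
    by (auto simp: ULayBidom_def compose_monoid_homs_assoc
        split: prod.splits dest!: semiring1_homs_monoid_homs layering_homs_monoid_homs)
qed


section \<open>The layered semiring of an ordered cancellative monoid\<close>

locale cancel_ord_monoid = tot_ord_monoid G + comm_monoid_cancel G
  for G :: "('g, 'c) ord_monoid_scheme" (structure)
begin

lemma strict_less_irrefl: "\<not> strict_less G a a"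
  by (simp add: strict_less_def)

lemma strict_less_asym: "strict_less G a b \<Longrightarrow> \<not> strict_less G b a"
  using linear
  by (auto simp: strict_less_def linear_order_on_def partial_order_on_def dest: antisymD)

lemma strict_less_trans: "\<lbrakk>strict_less G a b; strict_less G b c\<rbrakk> \<Longrightarrow> strict_less G a c"
  using linear
  by (auto simp: strict_less_def linear_order_on_def partial_order_on_def preorder_on_def
      dest: antisymD transD)

lemma strict_less_cases:
  assumes "a \<in> carrier G" "b \<in> carrier G"
  obtains "strict_less G a b" | "a = b" | "strict_less G b a"
  using linear assms by (auto simp: strict_less_def linear_order_on_def total_on_def)

text \<open>Cancellativity makes multiplication strictly monotone, which is what distributivity in
  the layered semiring needs.\<close>

lemma strict_less_mult:
  assumes "a \<in> carrier G" "b \<in> carrier G" "c \<in> carrier G" "strict_less G b c"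
  shows "strict_less G (a \<otimes> b) (a \<otimes> c)"
  using assms mult_mono l_cancel by (auto simp: strict_less_def)

end

section \<open>The bidomain structure on L x G\<close>

lemma nu_equiv_layered_of:
  "nu_equiv L (layered_of L G) x y \<longleftrightarrow>
    snd x = snd y \<and> (\<exists>m \<in> carrier L. (fst x, m) \<in> layer_le L \<and> (fst y, m) \<in> layer_le L)"
  by (cases x; cases y) (auto simp: nu_equiv_def layered_of_def)

lemma splus_layered_of:
  "(k, a) \<boxplus>\<^bsub>layered_of L G\<^esub> (l, b)
    = (if strict_less G b a then (k, a) else if strict_less G a b then (l, b) else (k \<boxplus>\<^bsub>L\<^esub> l, a))"
  by (simp add: layered_of_def)

text \<open>Multiplication on L x G is coordinatewise, so cancellation is required in L as well as
  in G; \<open>layered_of_cancel_imp_cancel\<close> shows that L cannot be spared.\<close>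

locale layered_of_cancel =
  L: layering_semiring L + L: comm_monoid_cancel L + G: cancel_ord_monoid G
  for L :: "'l layering" and G :: "'g ord_monoid"
begin

abbreviation "R \<equiv> layered_of L G"

lemma R_simps:
  "carrier R = carrier L \<times> carrier G"
  "(k, a) \<otimes>\<^bsub>R\<^esub> (l, b) = (k \<otimes>\<^bsub>L\<^esub> l, a \<otimes>\<^bsub>G\<^esub> b)"
  "\<one>\<^bsub>R\<^esub> = (\<one>\<^bsub>L\<^esub>, \<one>\<^bsub>G\<^esub>)"
  "sorting R x = fst x"
  "transit R m l (k, a) = (m, a)"
  by (simp_all add: layered_of_def)

lemma splus_R:
  "strict_less G b a \<Longrightarrow> (k, a) \<boxplus>\<^bsub>R\<^esub> (l, b) = (k, a)"
  "strict_less G a b \<Longrightarrow> (k, a) \<boxplus>\<^bsub>R\<^esub> (l, b) = (l, b)"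
  "(k, a) \<boxplus>\<^bsub>R\<^esub> (l, a) = (k \<boxplus>\<^bsub>L\<^esub> l, a)"
  by (simp_all add: splus_layered_of G.strict_less_asym G.strict_less_irrefl)

lemma layer_R: "(k, a) \<in> layer R l \<longleftrightarrow> k = l \<and> l \<in> carrier L \<and> a \<in> carrier G"
  by (auto simp: layer_def R_simps)

text \<open>Comparing a with b and b with c suffices. If b is smaller than both, each side is
  literally (k, a) + (m, c), so a and c need not be compared; chains of strict inequalities are
  settled by transitivity.\<close>

lemma splus_R_assoc:
  assumes "k \<in> carrier L" "l \<in> carrier L" "m \<in> carrier L"
    and "a \<in> carrier G" "b \<in> carrier G" "c \<in> carrier G"
  shows "((k, a) \<boxplus>\<^bsub>R\<^esub> (l, b)) \<boxplus>\<^bsub>R\<^esub> (m, c) = (k, a) \<boxplus>\<^bsub>R\<^esub> ((l, b) \<boxplus>\<^bsub>R\<^esub> (m, c))"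
  by (cases rule: G.strict_less_cases[OF assms(4,5)];
      cases rule: G.strict_less_cases[OF assms(5,6)];
      use assms in \<open>auto simp: splus_R L.splus_assoc dest: G.strict_less_trans\<close>)

lemma comm_semiring1_R: "comm_semiring1 R"
proof
  fix x y z assume xyz: "x \<in> carrier R" "y \<in> carrier R"
  obtain k a l b where [simp]: "x = (k, a)" "y = (l, b)" by fastforce
  have *: "k \<in> carrier L" "l \<in> carrier L" "a \<in> carrier G" "b \<in> carrier G"
    using xyz by (auto simp: R_simps)
  show "x \<otimes>\<^bsub>R\<^esub> y \<in> carrier R" and "x \<otimes>\<^bsub>R\<^esub> y = y \<otimes>\<^bsub>R\<^esub> x"
    using * by (auto simp: R_simps L.m_comm G.m_comm)
  show "x \<boxplus>\<^bsub>R\<^esub> y \<in> carrier R" and "x \<boxplus>\<^bsub>R\<^esub> y = y \<boxplus>\<^bsub>R\<^esub> x"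
    using *(3,4) by (cases rule: G.strict_less_cases;
        use * in \<open>auto simp: R_simps splus_R L.splus_closed L.splus_comm\<close>)+
  assume z: "z \<in> carrier R"
  obtain m c where [simp]: "z = (m, c)" by fastforce
  have **: "m \<in> carrier L" "c \<in> carrier G"
    using z by (auto simp: R_simps)
  show "x \<otimes>\<^bsub>R\<^esub> y \<otimes>\<^bsub>R\<^esub> z = x \<otimes>\<^bsub>R\<^esub> (y \<otimes>\<^bsub>R\<^esub> z)"
    using * ** by (auto simp: R_simps L.m_assoc G.m_assoc)
  show "(x \<boxplus>\<^bsub>R\<^esub> y) \<boxplus>\<^bsub>R\<^esub> z = x \<boxplus>\<^bsub>R\<^esub> (y \<boxplus>\<^bsub>R\<^esub> z)"
    using * ** by (simp add: splus_R_assoc)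
  show "x \<otimes>\<^bsub>R\<^esub> (y \<boxplus>\<^bsub>R\<^esub> z) = (x \<otimes>\<^bsub>R\<^esub> y) \<boxplus>\<^bsub>R\<^esub> (x \<otimes>\<^bsub>R\<^esub> z)"
    \<comment> \<open>The second coordinates of y and z are compared. By
      \<open>strict_less_mult\<close> the products with x compare in the same way, so both sides
      take the same branch; on a tie, distributivity in L applies.\<close>
    using *(4) **(2) by (cases rule: G.strict_less_cases;
        use * ** in \<open>auto simp: R_simps splus_R G.strict_less_mult L.distrib\<close>)
qed (auto simp: R_simps)

lemma uniform_layered_bidomain_R: "uniform_layered_bidomain L R"
proof -
  interpret R: comm_semiring1 R by (rule comm_semiring1_R)
  have le_refl: "(l, l) \<in> layer_le L" if "l \<in> carrier L" for l
    using that by (rule layer_le_refl[OF L.layering_semiring_axioms])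
  \<comment> \<open>The common bound is k + l itself: it lies above k by positivity and above itself
    by reflexivity.\<close>
  have nu_sum: "nu_equiv L R (k \<boxplus>\<^bsub>L\<^esub> l, a) (k, a)" if "k \<in> carrier L" "l \<in> carrier L" for k l a
    using that L.positive le_refl L.splus_closed
    by (auto simp: nu_equiv_layered_of intro!: bexI[of _ "k \<boxplus>\<^bsub>L\<^esub> l"])
  have nu_refl: "nu_equiv L R x x" if "x \<in> carrier R" for x
    using that le_refl by (fastforce simp: nu_equiv_layered_of R_simps)
  have cancel: "comm_monoid_cancel R"
    by (rule comm_monoid_cancelI) (auto simp: R_simps R.comm_monoid_axioms
        dest: L.r_cancel G.r_cancel)
  show ?thesis
  proof (intro uniform_layered_bidomain.intro layered_bidomain.intro layered_predomain.intro
      uniform_layered_bidomain_axioms.intro layered_bidomain_axioms.intro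
      layered_predomain_axioms.intro L.layering_semiring_axioms comm_semiring1_R cancel)
    fix k l assume kl: "k \<in> carrier L" "l \<in> carrier L"
    show "bij_betw (transit R l k) (layer R k) (layer R l)"
      \<comment> \<open>The formula for transit ignores the order of the layers, so the map in the
        opposite direction is an inverse even where the order does not run that way.\<close>
      by (rule bij_betw_byWitness[where f' = "transit R k l"])
        (use kl in \<open>auto simp: layer_R R_simps\<close>)
  next
    fix x y assume xy: "x \<in> carrier R" "y \<in> carrier R"
    then have "snd x \<in> carrier G" "snd y \<in> carrier G" by (auto simp: R_simps)
    then show "nu_equiv L R (x \<boxplus>\<^bsub>R\<^esub> y) x \<or> nu_equiv L R (x \<boxplus>\<^bsub>R\<^esub> y) y"
      by (cases rule: G.strict_less_cases; cases x; cases y;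
          use xy in \<open>auto simp: splus_R R_simps nu_sum nu_refl\<close>)
  next
    fix k l x y
    assume kl: "k \<in> carrier L" "l \<in> carrier L"
      and xy: "x \<in> layer R k" "y \<in> layer R l" "nu_equiv L R x y"
    \<comment> \<open>Nu-equivalence forces equal second coordinates, so the sum falls into the tie
      case and axiom (B), with its clause on infinity, is a statement about k + l.\<close>
    then obtain a where [simp]: "x = (k, a)" "y = (l, a)" and a: "a \<in> carrier G"
      by (cases x; cases y) (auto simp: layer_R nu_equiv_layered_of)
    show "x \<boxplus>\<^bsub>R\<^esub> y \<in> layer R (k \<boxplus>\<^bsub>L\<^esub> l) \<and> nu_equiv L R (x \<boxplus>\<^bsub>R\<^esub> y) x"
      using kl a by (simp add: splus_R layer_R nu_sum L.splus_closed)
    assume "infinite_layer L k"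
    then show "x \<boxplus>\<^bsub>R\<^esub> y = x"
      using kl by (simp add: splus_R infinite_layer_def)
  \<comment> \<open>The remaining axioms, (A1) to (A4) among them, are checked coordinatewise; (A4)
    is the tie case of addition.\<close>
  qed (auto simp: layer_R R_simps splus_R)
qed

end


section \<open>The layered map induced by an ordered homomorphism\<close>

lemma nu_equiv_layered_map:
  assumes "x \<in> carrier (layered_of L G)" "y \<in> carrier (layered_of L G)"
    and "nu_equiv L (layered_of L G) x y"
  shows "nu_equiv L (layered_of L H) (layered_map L G \<phi> x) (layered_map L G \<phi> y)"
  using assms
  by (cases x; cases y) (simp add: nu_equiv_layered_of layered_map_def, simp add: layered_of_def)

text \<open>Strict monotonicity of \<phi> sends each of the cases a < b, a = b, a > b to the same
  case for the images, so both sums are computed by the same branch.\<close>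

lemma layered_map_in_semiring1_homs:
  assumes G: "layered_of_cancel L G" and H: "layered_of_cancel L H"
    and \<phi>: "\<phi> \<in> ord_monoid_homs G H"
  shows "layered_map L G \<phi> \<in> semiring1_homs (layered_of L G) (layered_of L H)"
proof -
  interpret G: layered_of_cancel L G by fact
  interpret H: layered_of_cancel L H by fact
  note hom = monoid_homsD[OF ord_monoid_homsD(1)[OF \<phi>]]
    monoid_homs_closed[OF ord_monoid_homsD(1)[OF \<phi>]]
  have map: "layered_map L G \<phi> (k, a) = (k, \<phi> a)" if "k \<in> carrier L" "a \<in> carrier G" for k a
    using that by (simp add: layered_map_def)
  have add: "layered_map L G \<phi> (x \<boxplus>\<^bsub>layered_of L G\<^esub> y)
      = layered_map L G \<phi> x \<boxplus>\<^bsub>layered_of L H\<^esub> layered_map L G \<phi> y"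
    if xy: "x \<in> carrier (layered_of L G)" "y \<in> carrier (layered_of L G)" for x y
  proof -
    obtain k a l b where [simp]: "x = (k, a)" "y = (l, b)" by fastforce
    have *: "k \<in> carrier L" "l \<in> carrier L" "a \<in> carrier G" "b \<in> carrier G"
      using xy by (auto simp: G.R_simps)
    show ?thesis
      using *(3,4) by (cases rule: G.G.strict_less_cases;
        use * in \<open>auto simp: G.splus_R H.splus_R map G.L.splus_closed ord_monoid_homsD(2)[OF \<phi>]\<close>)
  qed
  have "layered_map L G \<phi> \<in> extensional (carrier (layered_of L G))"
    by (auto simp: layered_map_def G.R_simps)
  then show ?thesis
    by (auto simp: semiring1_homs_def monoid_homs_def hom_def G.R_simps H.R_simps map hom(3-5)
        add[unfolded G.R_simps])
qed

text \<open>The map keeps layers fixed, so with the identity on L the sorting condition is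
  reflexivity of the preorder.\<close>

lemma layered_map_in_Hom:
  assumes "layered_of_cancel L G" "layered_of_cancel L H" "\<phi> \<in> ord_monoid_homs G H"
  shows "(layered_map L G \<phi>, \<lambda>l \<in> carrier L. l)
    \<in> Hom ULayBidom (L, layered_of L G) (L, layered_of L H)"
proof -
  interpret layered_of_cancel L G by fact
  have "(\<lambda>l \<in> carrier L. l) \<in> layering_homs L L"
    by (rule layering_homs_id) (rule L.comm_semiring1_axioms)
  moreover have "((\<lambda>l \<in> carrier L. l) (sorting (layered_of L G) x),
      sorting (layered_of L H) (layered_map L G \<phi> x)) \<in> layer_le L"
    if "x \<in> carrier (layered_of L G)" for x
    using that layer_le_refl[OF L.layering_semiring_axioms]
    by (auto simp: layered_of_def layered_map_def)
  ultimately show ?thesis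
    using layered_map_in_semiring1_homs[OF assms] nu_equiv_layered_map
    by (auto simp: ULayBidom_Hom_iff)
qed


section \<open>Unit submonoids and the functor\<close>

lemma unit_submonoid_simps:
  "carrier (dom_monoid (unit_submonoid V))
    = {a \<in> carrier (dom_monoid V). valuation V a = \<one>\<^bsub>val_monoid V\<^esub>}"
  "mult (dom_monoid (unit_submonoid V)) = mult (dom_monoid V)"
  "one (dom_monoid (unit_submonoid V)) = one (dom_monoid V)"
  "carrier (val_monoid (unit_submonoid V)) = {\<one>\<^bsub>val_monoid V\<^esub>}"
  "mult (val_monoid (unit_submonoid V)) = mult (val_monoid V)"
  "one (val_monoid (unit_submonoid V)) = one (val_monoid V)"
  "le (val_monoid (unit_submonoid V))
    = le (val_monoid V) \<inter> {\<one>\<^bsub>val_monoid V\<^esub>} \<times> {\<one>\<^bsub>val_monoid V\<^esub>}"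
  "valuation (unit_submonoid V) = restrict (valuation V) (carrier (dom_monoid (unit_submonoid V)))"
  by (simp_all add: unit_submonoid_def Let_def)

text \<open>Elements of value 1 are closed under products because v is multiplicative. The value
  monoid is {1}, and it is attained since v 1 = 1.\<close>

lemma m_valuation_unit_submonoid:
  assumes "m_valuation V"
  shows "m_valuation (unit_submonoid V)"
proof -
  interpret M: comm_monoid "dom_monoid V" by (rule m_valuationD(1)[OF assms])
  interpret G: tot_ord_monoid "val_monoid V" by (rule m_valuationD(3)[OF assms])
  note v = monoid_homsD[OF m_valuationD(5)[OF assms]]
  have "comm_monoid (dom_monoid (unit_submonoid V))"
    by (rule comm_monoidI) (auto simp: unit_submonoid_simps v M.m_ac)
  moreover have "tot_ord_monoid (val_monoid (unit_submonoid V))"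
  proof (intro tot_ord_monoid.intro tot_ord_monoid_axioms.intro)
    show "comm_monoid (val_monoid (unit_submonoid V))"
      by (rule comm_monoidI) (auto simp: unit_submonoid_simps)
    have "(\<one>\<^bsub>val_monoid V\<^esub>, \<one>\<^bsub>val_monoid V\<^esub>) \<in> le (val_monoid V)"
      using G.linear by (auto simp: order_on_defs refl_on_def)
    then show "linear_order_on (carrier (val_monoid (unit_submonoid V)))
        (le (val_monoid (unit_submonoid V)))"
      by (auto simp: unit_submonoid_simps order_on_defs refl_on_def total_on_def
          intro!: antisymI transI)
  qed (auto simp: unit_submonoid_simps)
  moreover have "valuation (unit_submonoid V)
      \<in> monoid_homs (dom_monoid (unit_submonoid V)) (val_monoid (unit_submonoid V))"
    by (auto simp: monoid_homs_def hom_def unit_submonoid_simps v)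
  moreover have "valuation (unit_submonoid V) ` carrier (dom_monoid (unit_submonoid V))
      = carrier (val_monoid (unit_submonoid V))"
    using M.one_closed v(3) by (force simp: unit_submonoid_simps)
  ultimately show ?thesis by (simp add: m_valuation_def)
qed

lemma Hom_ValMon_unit_submonoid:
  assumes V: "m_valuation V" and p: "(f, g) \<in> Hom ValMon V W"
  shows "(restrict f (carrier (dom_monoid (unit_submonoid V))),
      restrict g (carrier (val_monoid (unit_submonoid V))))
    \<in> Hom ValMon (unit_submonoid V) (unit_submonoid W)"
proof -
  interpret M: comm_monoid "dom_monoid V" by (rule m_valuationD(1)[OF V])
  interpret G: tot_ord_monoid "val_monoid V" by (rule m_valuationD(3)[OF V])
  note v = monoid_homsD[OF m_valuationD(5)[OF V]]
  have f: "f \<in> monoid_homs (dom_monoid V) (dom_monoid W)"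
    and g: "g \<in> monoid_homs (val_monoid V) (val_monoid W)"
    and vf: "\<And>a. a \<in> carrier (dom_monoid V) \<Longrightarrow> valuation W (f a) = g (valuation V a)"
    using p by (auto simp: ValMon_def ord_monoid_homs_def)
  note f' = monoid_homsD(2-4)[OF f] monoid_homs_closed[OF f]
  have g1: "g \<one>\<^bsub>val_monoid V\<^esub> = \<one>\<^bsub>val_monoid W\<^esub>" by (rule monoid_homsD(3)[OF g])
  \<comment> \<open>Only V is known here to be an m-valuation, so this unit law in the value monoid
    of W is obtained as the image under g of the one for V.\<close>
  have "\<one>\<^bsub>val_monoid W\<^esub> \<otimes>\<^bsub>val_monoid W\<^esub> \<one>\<^bsub>val_monoid W\<^esub> = \<one>\<^bsub>val_monoid W\<^esub>"
    using monoid_homsD(4)[OF g, of "\<one>\<^bsub>val_monoid V\<^esub>" "\<one>\<^bsub>val_monoid V\<^esub>"] by (simp add: g1)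
  then show ?thesis
    by (auto simp: ValMon_def ord_monoid_homs_def monoid_homs_def hom_def strict_less_def
        unit_submonoid_simps v f' vf g1)
qed

section \<open>Functoriality\<close>

lemma category_ULayBidom_ValMon_unit: "category (product_category ULayBidom ValMon_unit)"
  unfolding ValMon_unit_def
  by (intro category_product_category category_ULayBidom category_full_subcategory category_ValMon)

lemma Ob_ValMon_plus:
  "V \<in> Ob ValMon_plus \<longleftrightarrow> m_valuation V \<and> comm_monoid_cancel (val_monoid V)"
  by (simp add: ValMon_plus_def full_subcategory_def ValMon_def)

lemma ValMon_plus_simps:
  "Hom ValMon_plus = Hom ValMon" "Ident ValMon_plus = Ident ValMon"
  "Comp ValMon_plus = Comp ValMon"
  by (simp_all add: ValMon_plus_def full_subcategory_def)

lemma ValMon_unit_simps: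
  "Ob ValMon_unit = Ob ValMon \<inter> unit_submonoid ` Ob ValMon"
  "Hom ValMon_unit = Hom ValMon" "Ident ValMon_unit = Ident ValMon"
  "Comp ValMon_unit = Comp ValMon"
  by (simp_all add: ValMon_unit_def full_subcategory_def)

theorem proposition6p10:
  fixes L :: "'l layering"
  assumes "layering_semiring L"
    and "comm_monoid_cancel L"
  shows "is_functor
    (ValMon_plus :: (('m, 'g) valued_monoid, ('m \<Rightarrow> 'm) \<times> ('g \<Rightarrow> 'g)) cat)
    (product_category ULayBidom ValMon_unit)
    (LTrop_unit_ob L) (LTrop_unit_mor L)"
proof (intro is_functor.intro is_functor_axioms.intro category_ULayBidom_ValMon_unit)
  show "category (ValMon_plus :: (('m, 'g) valued_monoid, _) cat)"
    unfolding ValMon_plus_def by (intro category_full_subcategory category_ValMon)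
next
  have layered: "layered_of_cancel L (val_monoid V)"
    if "V \<in> Ob ValMon_plus" for V :: "('m, 'g) valued_monoid"
    using that assms m_valuationD(3)
    by (auto simp: Ob_ValMon_plus layered_of_cancel_def cancel_ord_monoid_def)
  fix U V W :: "('m, 'g) valued_monoid" and p q
  assume U: "U \<in> Ob ValMon_plus"
  then have mU: "m_valuation U" by (simp add: Ob_ValMon_plus)
  show "LTrop_unit_ob L U \<in> Ob (product_category ULayBidom ValMon_unit)"
    using mU m_valuation_unit_submonoid[OF mU]
      layered_of_cancel.uniform_layered_bidomain_R[OF layered[OF U]]
    by (auto simp: product_category_def LTrop_unit_ob_def ULayBidom_def ValMon_unit_simps ValMon_def)
  show "LTrop_unit_mor L U U (Ident ValMon_plus U)
      = Ident (product_category ULayBidom ValMon_unit) (LTrop_unit_ob L U)"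
    \<comment> \<open>The value part of the unit arrow lives on {1}; membership of 1 in the carrier
      lets the restricted identity be evaluated there.\<close>
    using monoid.one_closed[OF m_valuationD(4)[OF mU]]
    by (auto simp: product_category_def LTrop_unit_ob_def LTrop_unit_mor_def ULayBidom_def
        ValMon_plus_simps ValMon_unit_simps ValMon_def layered_map_def layered_of_def
        unit_submonoid_simps restrict_def fun_eq_iff)
  assume V: "V \<in> Ob ValMon_plus" and p: "p \<in> Hom ValMon_plus U V"
  obtain f g where [simp]: "p = (f, g)" by force
  have p': "(f, g) \<in> Hom ValMon U V"
    using p by (simp add: ValMon_plus_simps)
  then have f: "f \<in> monoid_homs (dom_monoid U) (dom_monoid V)"
    and g: "g \<in> ord_monoid_homs (val_monoid U) (val_monoid V)"
    and vf: "\<And>a. a \<in> carrier (dom_monoid U) \<Longrightarrow> valuation V (f a) = g (valuation U a)"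
    by (auto simp: ValMon_def)
  note g' = ord_monoid_homsD(1)[OF g]
  show "LTrop_unit_mor L U V p
      \<in> Hom (product_category ULayBidom ValMon_unit) (LTrop_unit_ob L U) (LTrop_unit_ob L V)"
    using layered_map_in_Hom[OF layered[OF U] layered[OF V] g] Hom_ValMon_unit_submonoid[OF mU p']
    by (simp add: product_category_def LTrop_unit_ob_def LTrop_unit_mor_def ValMon_unit_simps)
  show "LTrop_unit_mor L U W (Comp ValMon_plus U V W q p)
      = Comp (product_category ULayBidom ValMon_unit)
          (LTrop_unit_ob L U) (LTrop_unit_ob L V) (LTrop_unit_ob L W)
          (LTrop_unit_mor L V W q) (LTrop_unit_mor L U V p)"
    \<comment> \<open>Restricting the composite agrees with composing the restrictions because
      \<open>vf\<close> and g 1 = 1 keep f a in the unit submonoid of V, where the restriction of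
      the second morphism is still defined.\<close>
    using monoid.one_closed[OF m_valuationD(4)[OF mU]]
    by (auto simp: product_category_def LTrop_unit_ob_def LTrop_unit_mor_def ULayBidom_def
        ValMon_plus_simps ValMon_unit_simps ValMon_def layered_map_def layered_of_def compose_def
        unit_submonoid_simps vf monoid_homs_closed[OF f] monoid_homs_closed[OF g']
        monoid_homsD(3)[OF g'] fun_eq_iff)
qed

end
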